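(* Let $(e_i)$ be a family of linearly independent polynomials in one variable $x$ (such as $1,x,x^2,x^3,\dots$), let $\mathbb{V}$ be the space they span, and let $P_i$ be the projection operators associated with the basis $(e_i)$ of $\mathbb{V}$. Let $O_i$ be linear operators on $\mathbb{V}$ such that the polynomials $e'_i:=O_ie_i$ form a new basis of $\mathbb{V}$. Let $\mathfrak{D}$ be a differential operator on $\mathbb{V}$ having the $e_i$ as its eigenfunctions, and let $\mathfrak{D}'$ be the corresponding differential operator on $\mathbb{V}$ having the new polynomials $e'_i$ as its eigenfunctions, with eigenvalues $\lambda'_i$, i.e. $\mathfrak{D}'e'_i=\lambda'_ie'_i$ for all $i$. Then $$\mathfrak{D}'=\Big(\sum_k\lambda'_kO_kP_k\Big)\Big(\sum_jO_jP_j\Big)^{-1}.$$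
   Context: The projection operators $P_i$ associated with a basis $(e_i)$ are the linear operators on $\mathbb{V}$ determined by $P_ie_j=\delta_{ij}e_i$. "Basis" is meant in the algebraic sense; when the family is infinite, the sums $\sum_k\lambda'_kO_kP_k$ and $\sum_jO_jP_j$ are understood pointwise, having only finitely many non-zero terms when applied to a given element of $\mathbb{V}$. The $O_i$ ("separated basis transformations") are linear operators on the whole space, with only the value $O_ie_i=e'_i$ prescribed. *)

theory Defs
  imports
    "HOL-Computational_Algebra.Computational_Algebra"
    "HOL-Library.Groups_Big_Fun"
begin

global_interpretation poly_vs: vector_space "smult :: 'a::field \<Rightarrow> 'a poly \<Rightarrow> 'a poly"
  by unfold_locales (simp_all add: smult_add_right smult_add_left)

(* Linear independence of a family rather than of its range: repetitions are excluded. *)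
definition independent_family :: "('i \<Rightarrow> 'a::field poly) \<Rightarrow> bool" where
  "independent_family e \<longleftrightarrow> inj e \<and> poly_vs.independent (range e)"

definition basis_family :: "'a::field poly set \<Rightarrow> ('i \<Rightarrow> 'a poly) \<Rightarrow> bool" where
  "basis_family V e \<longleftrightarrow> independent_family e \<and> poly_vs.span (range e) = V"

(* Operators on a subspace V are total functions of which only the values on V matter. *)
definition linear_operator_on :: "'a::field poly set \<Rightarrow> ('a poly \<Rightarrow> 'a poly) \<Rightarrow> bool" where
  "linear_operator_on V T \<longleftrightarrow>
     T ` V \<subseteq> V \<and>
     (\<forall>f\<in>V. \<forall>g\<in>V. T (f + g) = T f + T g) \<and>
     (\<forall>c. \<forall>f\<in>V. T (smult c f) = smult c (T f))"

definition projection_operators ::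
    "'a::field poly set \<Rightarrow> ('i \<Rightarrow> 'a poly) \<Rightarrow> ('i \<Rightarrow> 'a poly \<Rightarrow> 'a poly) \<Rightarrow> bool" where
  "projection_operators V e P \<longleftrightarrow>
     (\<forall>i. linear_operator_on V (P i)) \<and> (\<forall>i j. P i (e j) = (if i = j then e i else 0))"

(* The operator sum_k a_k(x) (d/dx)^k. The coefficients are rational functions (as happens when V
   is not the space of all polynomials), and infinitely many of them may be nonzero: on a given
   polynomial f all terms with k > degree f vanish. Operators of finite order are those with
   a_k = 0 for all large k, see differential_operator_on_finite_order below. *)
definition differential_operator_on :: "'a::field_char_0 poly set \<Rightarrow> ('a poly \<Rightarrow> 'a poly) \<Rightarrow> bool" where
  "differential_operator_on V D \<longleftrightarrow>
     linear_operator_on V D \<and>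
     (\<exists>a :: nat \<Rightarrow> 'a poly fract. \<forall>f\<in>V.
        to_fract (D f) = (\<Sum>k\<le>degree f. a k * to_fract ((pderiv ^^ k) f)))"

(* Pointwise sum of a family of operators; Sum_any sums the nonzero terms provided they are finitely
   many, which holds for sums of the form sum_k T_k P_k by finite_projections below. *)
definition operator_sum :: "('i \<Rightarrow> 'a::field poly \<Rightarrow> 'a poly) \<Rightarrow> 'a poly \<Rightarrow> 'a poly" where
  "operator_sum T f = Sum_any (\<lambda>i. T i f)"

lemma finite_projections:
  assumes "basis_family V e" "projection_operators V e P" "f \<in> V"
  shows "finite {i. P i f \<noteq> 0}"
proof -
  have V: "V = poly_vs.span (range e)"
    using assms(1) by (simp add: basis_family_def)
  have lin: "linear_operator_on V (P i)" for i
    using assms(2) by (simp add: projection_operators_def)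
  have Pe: "P i (e j) = (if i = j then e i else 0)" for i j
    using assms(2) by (simp add: projection_operators_def)
  have "f \<in> poly_vs.span (range e)" using assms(3) V by simp
  then have "f \<in> V \<and> finite {i. P i f \<noteq> 0}"
  proof (induction rule: poly_vs.span_induct_alt)
    case base
    have "0 \<in> V" by (simp add: V poly_vs.span_zero)
    then have "P i (smult 0 0) = smult 0 (P i 0)" for i
      using lin[of i] unfolding linear_operator_on_def by blast
    then show ?case using \<open>0 \<in> V\<close> by simp
  next
    case (step c x y)
    then obtain j where x: "x = e j" by blast
    have xV: "x \<in> V" using step(1) V by (simp add: poly_vs.span_base)
    then have cV: "smult c x \<in> V" by (simp add: V poly_vs.span_scale)
    have "P i (smult c x + y) = smult c (P i x) + P i y" for i
      using lin[of i] xV cV step unfolding linear_operator_on_def by auto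
    then have "{i. P i (smult c x + y) \<noteq> 0} \<subseteq> insert j {i. P i y \<noteq> 0}"
      by (auto simp: x Pe)
    moreover have "smult c x + y \<in> V"
      using cV step by (simp add: V poly_vs.span_add)
    ultimately show ?case using step by (meson finite_insert finite_subset)
  qed
  then show ?thesis ..
qed

lemma differential_operator_on_finite_order:
  fixes a :: "nat \<Rightarrow> 'a::field_char_0 poly fract"
  assumes "linear_operator_on V D"
    and "\<And>f. f \<in> V \<Longrightarrow> to_fract (D f) = (\<Sum>k\<le>n. a k * to_fract ((pderiv ^^ k) f))"
  shows "differential_operator_on V D"
proof -
  define b where "b k = (if k \<le> n then a k else 0)" for k
  have "to_fract (D f) = (\<Sum>k\<le>degree f. b k * to_fract ((pderiv ^^ k) f))" if "f \<in> V" for f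
  proof -
    have vanish: "(pderiv ^^ k) f = 0" if "degree f < k" for k
      using that by (intro poly_eqI) (simp add: coeff_higher_pderiv coeff_eq_0)
    have "to_fract (D f) = (\<Sum>k\<le>n. b k * to_fract ((pderiv ^^ k) f))"
      using assms(2)[OF that] by (simp add: b_def)
    also have "\<dots> = (\<Sum>k\<le>max n (degree f). b k * to_fract ((pderiv ^^ k) f))"
      by (rule sum.mono_neutral_left) (auto simp: b_def)
    also have "\<dots> = (\<Sum>k\<le>degree f. b k * to_fract ((pderiv ^^ k) f))"
      by (rule sum.mono_neutral_right) (auto simp: vanish)
    finally show ?thesis .
  qed
  then show ?thesis using assms(1) unfolding differential_operator_on_def by blast
qed

end

theory Submission
  imports Defs
begin

text \<open>The operators \<open>\<Sum>\<^sub>k c\<^sub>k T\<^sub>k P\<^sub>k\<close> are linear and send \<open>e\<^sub>j\<close> to \<open>c\<^sub>j e'\<^sub>j\<close>. For \<open>c = 1\<close> this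
  carries one basis to another, hence is bijective; for \<open>c\<^sub>k = \<lambda>'\<^sub>k\<close> it agrees on the basis \<open>e\<close> with
  \<open>\<D>'\<close> composed with the first operator.\<close>

text \<open>Indexing the combination by the family, not by the vectors in its range, lets the same
  \<open>F\<close> and \<open>c\<close> be reused with \<open>e'\<close> in place of
  \<open>e\<close>.\<close>

lemma span_range_sum:
  assumes "f \<in> poly_vs.span (range e)"
  obtains F c where "finite F" "f = (\<Sum>i\<in>F. smult (c i) (e i))"
proof -
  have "\<exists>F c. finite F \<and> f = (\<Sum>i\<in>F. smult (c i) (e i))"
    using assms
  proof (induction rule: poly_vs.span_induct_alt)
    case base
    then show ?case by (intro exI[of _ "{}"]) simp
  next
    case (step a x y)
    then obtain j F c where j: "x = e j" and F: "finite F" "y = (\<Sum>i\<in>F. smult (c i) (e i))"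
      by blast
    \<comment> \<open>The index \<open>j\<close> may or may not lie in \<open>F\<close>, and
      \<open>c\<close> is arbitrary outside \<open>F\<close>. Extending by zero puts both summands
      over the common index set \<open>insert j F\<close>.\<close>
    define c0 where "c0 i = (if i \<in> F then c i else 0)" for i
    have y: "y = (\<Sum>i\<in>insert j F. smult (c0 i) (e i))"
      unfolding F(2) using F(1) by (intro sum.mono_neutral_cong_left) (auto simp: c0_def)
    have x: "smult a x = (\<Sum>i\<in>insert j F. smult (if i = j then a else 0) (e i))"
      using F(1) by (simp add: j if_distrib[of "\<lambda>c. smult c _"] cong: if_cong)
    have "smult a x + y = (\<Sum>i\<in>insert j F. smult ((if i = j then a else 0) + c0 i) (e i))"
      by (simp only: x y smult_add_left sum.distrib)
    then show ?case
      using F(1) by (intro exI[of _ "insert j F"] exI conjI) (rule finite.insertI)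
  qed
  then show thesis using that by blast
qed

lemma sum_in_span_range: "(\<Sum>i\<in>F. smult (c i) (e i)) \<in> poly_vs.span (range e)"
  by (intro poly_vs.span_sum poly_vs.span_scale poly_vs.span_base) simp

text \<open>Independence in \<open>poly_vs\<close> concerns sets of vectors. Since \<open>e\<close>
  is injective, a coefficient of an index becomes a coefficient of a vector through
  \<open>inv e\<close>.\<close>

lemma independent_family_sum_zeroD:
  assumes "independent_family e" "finite F" "(\<Sum>i\<in>F. smult (c i) (e i)) = 0" "i \<in> F"
  shows "c i = 0"
proof -
  have inj: "inj e" and ind: "poly_vs.independent (range e)"
    using assms(1) by (auto simp: independent_family_def)
  have "(\<Sum>v\<in>e ` F. smult (c (inv e v)) v) = (\<Sum>i\<in>F. smult (c i) (e i))"
    using inj by (simp add: sum.reindex inj_on_subset[OF inj])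
  then have "c (inv e (e i)) = 0"
    using poly_vs.independentD[OF ind, of "e ` F" "\<lambda>v. c (inv e v)" "e i"] assms by auto
  then show ?thesis using inj by simp
qed

lemma linear_operator_on_zero:
  assumes "linear_operator_on V A" "0 \<in> V"
  shows "A 0 = 0"
proof -
  have "A (smult 0 0) = smult 0 (A 0)"
    using assms unfolding linear_operator_on_def by blast
  then show ?thesis by simp
qed

lemma linear_operator_on_comp:
  assumes "linear_operator_on V A" "linear_operator_on V B"
  shows "linear_operator_on V (\<lambda>f. A (B f))"
  using assms unfolding linear_operator_on_def by (auto simp: image_subset_iff)

lemma linear_operator_on_smult:
  assumes "linear_operator_on V A" "poly_vs.subspace V"
  shows "linear_operator_on V (\<lambda>f. smult c (A f))"
  using assms unfolding linear_operator_on_def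
  by (auto simp: image_subset_iff smult_add_right mult.commute intro: poly_vs.subspace_scale)

lemma linear_operator_on_sum:
  assumes "linear_operator_on V A" "poly_vs.subspace V" "finite F" "\<And>i. i \<in> F \<Longrightarrow> e i \<in> V"
  shows "A (\<Sum>i\<in>F. smult (c i) (e i)) = (\<Sum>i\<in>F. smult (c i) (A (e i)))"
  using assms(3,4)
proof (induction F rule: finite_induct)
  case empty
  show ?case
    using linear_operator_on_zero[OF assms(1)] poly_vs.subspace_0[OF assms(2)] by simp
next
  case (insert j F)
  \<comment> \<open>Additivity and homogeneity of \<open>A\<close> are available on \<open>V\<close>
    only, so membership of the remaining sum and of the new term must come before splitting.\<close>
  have "(\<Sum>i\<in>F. smult (c i) (e i)) \<in> V" "smult (c j) (e j) \<in> V" "e j \<in> V"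
    using insert assms(2)
    by (auto intro!: poly_vs.subspace_sum[OF assms(2)] poly_vs.subspace_scale[OF assms(2)])
  then show ?case
    using insert assms(1) unfolding linear_operator_on_def by auto
qed

text \<open>\<open>Sum_any\<close> defaults to 0 on an infinite support, which would break
  additivity. Pointwise finite support turns each value into a genuine finite sum.\<close>

lemma linear_operator_on_operator_sum:
  assumes V: "poly_vs.subspace V"
    and U: "\<And>i. linear_operator_on V (U i)"
    and fin: "\<And>f. f \<in> V \<Longrightarrow> finite {i. U i f \<noteq> 0}"
  shows "linear_operator_on V (operator_sum U)"
proof -
  have "operator_sum U f \<in> V" if "f \<in> V" for f
    using that U unfolding operator_sum_def Sum_any.expand_set linear_operator_on_def
    by (intro poly_vs.subspace_sum[OF V]) blast
  moreover have "operator_sum U (f + g) = operator_sum U f + operator_sum U g"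
    if "f \<in> V" "g \<in> V" for f g
  proof -
    have "U i (f + g) = U i f + U i g" for i
      using that U unfolding linear_operator_on_def by blast
    then show ?thesis
      unfolding operator_sum_def using Sum_any.distrib[OF fin[OF that(1)] fin[OF that(2)]] by simp
  qed
  moreover have "operator_sum U (smult c f) = smult c (operator_sum U f)" if "f \<in> V" for c f
  proof -
    have "U i (smult c f) = smult c (U i f)" for i
      using that U unfolding linear_operator_on_def by blast
    \<comment> \<open>For \<open>c = 0\<close> the support of the left side is empty, so the sum is
      expanded over the possibly larger support at \<open>f\<close>.\<close>
    then have "operator_sum U (smult c f) = (\<Sum>i\<in>{i. U i f \<noteq> 0}. smult c (U i f))"
      unfolding operator_sum_def
      using fin[OF that] by (intro trans[OF Sum_any.expand_superset]) auto
    also have "\<dots> = smult c (operator_sum U f)"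
      unfolding operator_sum_def Sum_any.expand_set by (rule poly_vs.scale_sum_right[symmetric])
    finally show ?thesis .
  qed
  ultimately show ?thesis
    unfolding linear_operator_on_def by auto
qed

text \<open>The scalars \<open>c\<close> allow one argument to cover both factors of the formula:
  the inverted one and the one carrying the eigenvalues.\<close>

lemma
  fixes c :: "'i \<Rightarrow> 'a::field"
  assumes e: "basis_family V e" and P: "projection_operators V e P"
    and T: "\<And>i. linear_operator_on V (T i)"
  shows linear_operator_on_projection_sum:
      "linear_operator_on V (operator_sum (\<lambda>k f. smult (c k) (T k (P k f))))" (is "linear_operator_on V ?S")
    and projection_sum_basis:
      "operator_sum (\<lambda>k f. smult (c k) (T k (P k f))) (e j) = smult (c j) (T j (e j))"
proof -
  have V: "poly_vs.subspace V"
    using e by (auto simp: basis_family_def)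
  have T0: "T i 0 = 0" for i
    using linear_operator_on_zero[OF T poly_vs.subspace_0[OF V]] .
  \<comment> \<open>As \<open>T i\<close> fixes 0, a term can be nonzero only where
    \<open>P i f\<close> is nonzero.\<close>
  have "finite {i. smult (c i) (T i (P i f)) \<noteq> 0}" if "f \<in> V" for f
    by (rule finite_subset[OF _ finite_projections[OF e P that]]) (auto simp: T0)
  moreover have "linear_operator_on V (\<lambda>f. smult (c k) (T k (P k f)))" for k
    using P by (intro linear_operator_on_smult[OF linear_operator_on_comp[OF T] V])
      (simp add: projection_operators_def)
  ultimately show "linear_operator_on V ?S"
    by (intro linear_operator_on_operator_sum[OF V])
  \<comment> \<open>Every index \<open>k\<close> other than \<open>j\<close> contributes
    \<open>T k 0 = 0\<close>.\<close>
  have "?S (e j) = (\<Sum>k\<in>{j}. smult (c k) (T k (P k (e j))))"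
    unfolding operator_sum_def using P
    by (intro Sum_any.expand_superset) (auto simp: projection_operators_def T0)
  then show "?S (e j) = smult (c j) (T j (e j))"
    using P by (simp add: projection_operators_def)
qed

text \<open>\<open>S\<close> keeps coefficients and replaces \<open>e\<close> by \<open>e'\<close>.
  Hence independence of \<open>e'\<close> makes the kernel trivial, and spanning by
  \<open>e'\<close> gives surjectivity.\<close>

lemma bij_betw_basis:
  assumes e: "basis_family V e" and e': "basis_family V e'"
    and S: "linear_operator_on V S" and Se: "\<And>i. S (e i) = e' i"
  shows "bij_betw S V V"
proof -
  have V: "poly_vs.subspace V" and sp: "V = poly_vs.span (range e)" "V = poly_vs.span (range e')"
    using e e' by (auto simp: basis_family_def)
  have eV: "e i \<in> V" for i
    unfolding sp(1) by (simp add: poly_vs.span_base)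
  have Ssum: "S (\<Sum>i\<in>F. smult (c i) (e i)) = (\<Sum>i\<in>F. smult (c i) (e' i))" if "finite F" for F c
    using linear_operator_on_sum[OF S V that, of e c] eV Se by simp
  have ker: "f = 0" if "f \<in> V" "S f = 0" for f
  proof -
    from that(1) obtain F c where F: "finite F" "f = (\<Sum>i\<in>F. smult (c i) (e i))"
      unfolding sp(1) by (rule span_range_sum)
    have "c i = 0" if "i \<in> F" for i
      using independent_family_sum_zeroD[of e' F c i] e' F \<open>S f = 0\<close> Ssum that
      by (simp add: basis_family_def)
    then show ?thesis using F by simp
  qed
  have "inj_on S V"
  proof (rule inj_onI)
    fix f g assume fg: "f \<in> V" "g \<in> V" "S f = S g"
    \<comment> \<open>The difference is written with \<open>smult (- 1)\<close> because
      \<open>linear_operator_on\<close> speaks of sums and scalar multiples only.\<close>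
    have "smult (- 1) g \<in> V" "S (smult (- 1) g) = smult (- 1) (S g)"
      using fg V S poly_vs.subspace_scale unfolding linear_operator_on_def by blast+
    moreover have "S (f + smult (- 1) g) = S f + S (smult (- 1) g)"
      using fg calculation(1) S unfolding linear_operator_on_def by blast
    ultimately have "f + smult (- 1) g = 0"
      using fg(1,3) by (intro ker[OF poly_vs.subspace_add[OF V]]) simp_all
    then show "f = g" by simp
  qed
  moreover have "V \<subseteq> S ` V"
  proof
    fix f assume "f \<in> V"
    then obtain F c where F: "finite F" "f = (\<Sum>i\<in>F. smult (c i) (e' i))"
      unfolding sp(2) by (rule span_range_sum)
    have "(\<Sum>i\<in>F. smult (c i) (e i)) \<in> V"
      unfolding sp(1) by (rule sum_in_span_range)
    moreover have "f = S (\<Sum>i\<in>F. smult (c i) (e i))"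
      using F Ssum by simp
    ultimately show "f \<in> S ` V"
      by (rule rev_image_eqI)
  qed
  moreover have "S ` V \<subseteq> V"
    using S by (simp add: linear_operator_on_def)
  ultimately show ?thesis by (auto simp: bij_betw_def)
qed

theorem theorem2p5:
  fixes e e' :: "'i \<Rightarrow> 'a::field_char_0 poly"
    and V :: "'a poly set"
    and P T :: "'i \<Rightarrow> 'a poly \<Rightarrow> 'a poly"
    and D D' :: "'a poly \<Rightarrow> 'a poly"
    and ev ev' :: "'i \<Rightarrow> 'a"
  assumes "independent_family e"
    and "V = poly_vs.span (range e)"
    and "projection_operators V e P"
    and "\<And>i. linear_operator_on V (T i)"
    and "\<And>i. e' i = T i (e i)"
    and "basis_family V e'"
    and "differential_operator_on V D"
    and "\<And>i. D (e i) = smult (ev i) (e i)"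
    and "differential_operator_on V D'"
    and "\<And>i. D' (e' i) = smult (ev' i) (e' i)"
  shows "bij_betw (operator_sum (\<lambda>j f. T j (P j f))) V V \<and>
    (\<forall>f\<in>V. D' f =
       operator_sum (\<lambda>k f. smult (ev' k) (T k (P k f)))
         (inv_into V (operator_sum (\<lambda>j f. T j (P j f))) f))"
proof -
  let ?S = "operator_sum (\<lambda>j f. T j (P j f))"
  let ?R = "operator_sum (\<lambda>k f. smult (ev' k) (T k (P k f)))"
  have e: "basis_family V e"
    using assms(1,2) by (simp add: basis_family_def)
  have V: "poly_vs.subspace V"
    using assms(2) by simp
  have eV: "e i \<in> V" and e'V: "e' i \<in> V" for i
    using assms(6) by (auto simp: assms(2) basis_family_def intro: poly_vs.span_base)
  have S: "linear_operator_on V ?S" "?S (e j) = e' j" for j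
    using linear_operator_on_projection_sum[OF e assms(3,4), of "\<lambda>_. 1"]
      projection_sum_basis[OF e assms(3,4), of "\<lambda>_. 1"] assms(5) by simp_all
  have R: "linear_operator_on V ?R" "?R (e j) = smult (ev' j) (e' j)" for j
    using linear_operator_on_projection_sum[OF e assms(3,4)]
      projection_sum_basis[OF e assms(3,4)] assms(5) by simp_all
  have D': "linear_operator_on V D'"
    using assms(9) by (simp add: differential_operator_on_def)
  have bij: "bij_betw ?S V V"
    by (rule bij_betw_basis[OF e assms(6) S])
  \<comment> \<open>The intertwining relation on \<open>V\<close>: expanded in the basis
    \<open>e\<close>, both sides become the combination of the \<open>e' i\<close> with coefficients
    \<open>c i * ev' i\<close>.\<close>
  have D'S: "D' (?S g) = ?R g" if "g \<in> V" for g
  proof -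
    from that obtain F c where F: "finite F" "g = (\<Sum>i\<in>F. smult (c i) (e i))"
      unfolding assms(2) by (rule span_range_sum)
    have "?S g = (\<Sum>i\<in>F. smult (c i) (e' i))"
      unfolding F(2) using linear_operator_on_sum[OF S(1) V F(1)] eV S(2) by simp
    then have "D' (?S g) = (\<Sum>i\<in>F. smult (c i) (smult (ev' i) (e' i)))"
      using linear_operator_on_sum[OF D' V F(1)] e'V assms(10) by simp
    also have "\<dots> = ?R g"
      unfolding F(2) using linear_operator_on_sum[OF R(1) V F(1), of e c] eV R(2) by simp
    finally show ?thesis .
  qed
  have "D' f = ?R (inv_into V ?S f)" if "f \<in> V" for f
  proof -
    \<comment> \<open>Surjectivity ensures that \<open>inv_into\<close> picks a true preimage
      \<open>g\<close> of \<open>f\<close> in \<open>V\<close>, to which \<open>D'S\<close>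
      applies.\<close>
    from that have "f \<in> ?S ` V"
      by (simp only: bij_betw_imp_surj_on[OF bij])
    then show ?thesis
      using D'S[OF inv_into_into, of f ?S] by (simp only: f_inv_into_f)
  qed
  with bij show ?thesis by blast
qed

end
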